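(* Let $E$ be a finite set and let $r: 2^E\to \mathbb{Z}_{\geq 0}$ be a function on the subsets of $E$ satisfying $r(S)\leq \min(r(E),|S|)$ for every $S\subseteq E$. Let $$T_M(x,y)=\sum_{S\subseteq E}(x-1)^{r(E)-r(S)}(y-1)^{|S|-r(S)}$$ be the Tutte polynomial of the system $M=(E,r)$, and let $t_{ij}$ ($i,j\ge 0$) be its coefficients, so that $T_M(x,y)=\sum_{i,j}t_{ij}x^iy^j$. Let $m=|E|$. Then for every integer $h\geq 0$, $$\sum_{i=0}^h\sum_{j=0}^{h-i}\binom{h-i}{j}(-1)^jt_{ij}=(-1)^{m-r(E)}\binom{h-r(E)}{h-m},$$ where, when $h<m$, the binomial coefficient $\binom{h-r(E)}{h-m}$ is interpreted as $0$.
   Context: The function $r$ is not assumed to be submodular or monotone; the only assumption is the displayed inequality $r(S)\leq \min(r(E),|S|)$ for all $S\subseteq E$. In particular all exponents in the definition of $T_M$ are nonnegative integers, so $T_M(x,y)$ is a polynomial with integer coefficients in the two variables $x,y$; $t_{ij}$ denotes the coefficient of $x^iy^j$ (equal to $0$ if the monomial does not occur). *)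

theory Defs
  imports Main "HOL-Computational_Algebra.Polynomial"
begin

text \<open>
  A polynomial in the two variables \<open>x\<close>, \<open>y\<close> over the integers is represented as an element of
  \<open>int poly poly\<close>, that is, of \<open>\<int>[y][x]\<close>: the outer variable is \<open>x\<close>, the inner one is \<open>y\<close>.
\<close>

definition var_x :: "int poly poly" where
  "var_x = [:0, 1:]"

definition var_y :: "int poly poly" where
  "var_y = [:[:0, 1:]:]"

text \<open>
  The subtractions in the exponents are on \<open>nat\<close>; they do not truncate for the systems of
  interest, which satisfy \<open>r S \<le> min (r E) (card S)\<close> for all \<open>S \<subseteq> E\<close>.
\<close>

definition tutte_poly :: "'a set \<Rightarrow> ('a set \<Rightarrow> nat) \<Rightarrow> int poly poly" where
  "tutte_poly E r =
     (\<Sum>S\<in>Pow E. (var_x - 1) ^ (r E - r S) * (var_y - 1) ^ (card S - r S))"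

definition tutte_coeff :: "'a set \<Rightarrow> ('a set \<Rightarrow> nat) \<Rightarrow> nat \<Rightarrow> nat \<Rightarrow> int" where
  "tutte_coeff E r i j = coeff (coeff (tutte_poly E r) i) j"

end

theory Submission
  imports Defs "HOL-Computational_Algebra.Formal_Power_Series"
begin

text \<open>
  Call the left-hand side \<open>L\<^sub>h(T)\<close>. It is linear in \<open>T\<close>, and the generating function
  \<open>F(T) = \<Sum>\<^sub>h L\<^sub>h(T) z\<^sup>h\<close> of \<open>T = x\<^sup>i y\<^sup>j\<close> is \<open>z\<^sup>i (-z)\<^sup>j / (1 - z)\<^sup>j\<^sup>+\<^sup>1\<close>, so that
  \<open>F(T) = T(z, -z / (1 - z)) / (1 - z)\<close>. Under this substitution \<open>x - 1\<close> and \<open>y - 1\<close> become the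
  mutually inverse series \<open>-(1 - z)\<close> and \<open>-1 / (1 - z)\<close>, so the rank function cancels from every
  summand of the Tutte polynomial, and what remains is a binomial sum over the subsets of \<open>E\<close>.
\<close>

text \<open>The inner sum of the left-hand side at a fixed power x^i: \<open>n\<close> stands for h
  - i and \<open>q\<close> for the coefficient of x^i.\<close>

definition alt_binomial_sum :: "nat \<Rightarrow> int poly \<Rightarrow> int" where
  "alt_binomial_sum n q = (\<Sum>j\<le>n. int (n choose j) * (-1) ^ j * coeff q j)"

lemma alt_binomial_sum_0_pCons_0 [simp]: "alt_binomial_sum 0 (pCons 0 q) = 0"
  by (simp add: alt_binomial_sum_def)

text \<open>Pascal's rule; \<open>pCons 0\<close> is multiplication by y.\<close>

lemma alt_binomial_sum_Suc_pCons_0: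
  "alt_binomial_sum (Suc n) (pCons 0 q) = alt_binomial_sum n (pCons 0 q) - alt_binomial_sum n q"
proof -
  \<comment> \<open>The range may grow to \<open>Suc n\<close> since \<open>n choose Suc n\<close>
    is 0; the term at 0 then drops with the constant coefficient.\<close>
  have "alt_binomial_sum n (pCons 0 q)
      = (\<Sum>j\<le>Suc n. int (n choose j) * (-1) ^ j * coeff (pCons 0 q) j)"
    by (simp add: alt_binomial_sum_def)
  also have "\<dots> = (\<Sum>j\<le>n. int (n choose Suc j) * (-1) ^ Suc j * coeff q j)"
    by (subst sum.atMost_Suc_shift) simp
  finally have n: "alt_binomial_sum n (pCons 0 q) = \<dots>" .
  have "alt_binomial_sum (Suc n) (pCons 0 q)
      = (\<Sum>j\<le>n. int (Suc n choose Suc j) * (-1) ^ Suc j * coeff q j)"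
    unfolding alt_binomial_sum_def by (subst sum.atMost_Suc_shift) simp
  also have "\<dots> = alt_binomial_sum n (pCons 0 q) - alt_binomial_sum n q"
    unfolding n unfolding alt_binomial_sum_def
    by (simp add: ring_distribs sum_subtractf sum.distrib sum_negf mult_ac)
  finally show ?thesis .
qed

definition alt_gf :: "int poly poly \<Rightarrow> int fps" where
  "alt_gf p = Abs_fps (\<lambda>h. \<Sum>i\<le>h. alt_binomial_sum (h - i) (coeff p i))"

lemma alt_gf_add: "alt_gf (p + q) = alt_gf p + alt_gf q"
  by (rule fps_ext) (simp add: alt_gf_def alt_binomial_sum_def sum.distrib algebra_simps)

lemma alt_gf_0 [simp]: "alt_gf 0 = 0"
  by (rule fps_ext) (simp add: alt_gf_def alt_binomial_sum_def)

lemma alt_gf_diff: "alt_gf (p - q) = alt_gf p - alt_gf q"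
  using alt_gf_add [of "p - q" q] by simp

lemma alt_gf_sum: "alt_gf (\<Sum>a\<in>A. f a) = (\<Sum>a\<in>A. alt_gf (f a))"
  by (induction A rule: infinite_finite_induct) (simp_all add: alt_gf_add)

text \<open>The series 1 / (1 - z), given by its coefficients since \<open>int\<close> is not a
  field.\<close>

definition geometric_fps :: "int fps" where
  "geometric_fps = Abs_fps (\<lambda>_. 1)"

lemma one_minus_X_mult_geometric_fps: "(1 - fps_X) * geometric_fps = 1"
  by (rule fps_ext) (auto simp: geometric_fps_def left_diff_distrib split: nat.splits)

lemma alt_gf_1: "alt_gf 1 = geometric_fps"
proof (rule fps_ext)
  fix h
  have "alt_binomial_sum (h - i) (coeff 1 i) = (if i = 0 then 1 else 0)" for i
  proof -
    have "alt_binomial_sum n 1 = 1" for n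
      unfolding alt_binomial_sum_def
      by (subst sum.atMost_shift) (simp add: coeff_pCons flip: one_pCons)
    then show ?thesis by (cases i) (simp_all add: alt_binomial_sum_def)
  qed
  then show "fps_nth (alt_gf 1) h = fps_nth geometric_fps h"
    by (simp add: alt_gf_def geometric_fps_def)
qed

lemma alt_gf_var_x_mult: "alt_gf (var_x * p) = fps_X * alt_gf p"
proof (rule fps_ext)
  fix h
  have "alt_binomial_sum n 0 = 0" for n
    by (simp add: alt_binomial_sum_def)
  then show "fps_nth (alt_gf (var_x * p)) h = fps_nth (fps_X * alt_gf p) h"
    by (cases h) (simp_all add: alt_gf_def var_x_def sum.atMost_Suc_shift del: sum.atMost_Suc)
qed

text \<open>Cleared of the denominator 1 - z, the rule for a factor y becomes, coefficientwise, the
  Pascal recurrence above.\<close>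

lemma alt_gf_var_y_mult: "(1 - fps_X) * alt_gf (var_y * p) = - fps_X * alt_gf p"
proof (rule fps_ext)
  fix h
  show "fps_nth ((1 - fps_X) * alt_gf (var_y * p)) h = fps_nth (- fps_X * alt_gf p) h"
  proof (cases h)
    case 0
    then show ?thesis by (simp add: alt_gf_def var_y_def left_diff_distrib)
  next
    case (Suc k)
    \<comment> \<open>The term at i = \<open>Suc k\<close> vanishes by
      \<open>alt_binomial_sum_0_pCons_0\<close>, so all sums stop at \<open>k\<close>.\<close>
    have "(\<Sum>i\<le>k. alt_binomial_sum (Suc k - i) (pCons 0 (coeff p i)))
        = (\<Sum>i\<le>k. alt_binomial_sum (k - i) (pCons 0 (coeff p i)))
          - (\<Sum>i\<le>k. alt_binomial_sum (k - i) (coeff p i))"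
      by (simp add: Suc_diff_le alt_binomial_sum_Suc_pCons_0 flip: sum_subtractf)
    with Suc show ?thesis
      by (simp add: alt_gf_def var_y_def left_diff_distrib)
  qed
qed

lemma alt_gf_var_x_minus_1_mult: "alt_gf ((var_x - 1) * p) = - (1 - fps_X) * alt_gf p"
  by (simp add: left_diff_distrib alt_gf_diff alt_gf_var_x_mult)

lemma alt_gf_var_y_minus_1_mult: "alt_gf ((var_y - 1) * p) = - geometric_fps * alt_gf p"
proof -
  have "(1 - fps_X) * alt_gf ((var_y - 1) * p) = - alt_gf p"
    \<comment> \<open>Only \<open>var_y - 1\<close> is expanded, keeping \<open>1 - fps_X\<close> a
      factor; then -z - (1 - z) = -1.\<close>
    by (simp only: left_diff_distrib [of var_y] alt_gf_diff right_diff_distrib alt_gf_var_y_mult)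
      (simp add: algebra_simps)
  then have "geometric_fps * ((1 - fps_X) * alt_gf ((var_y - 1) * p)) = - geometric_fps * alt_gf p"
    by simp
  then show ?thesis
    using one_minus_X_mult_geometric_fps by (metis mult.assoc mult.commute mult_1)
qed

text \<open>Each factor acts by multiplication; the last \<open>geometric_fps\<close> is the value
  at the empty product.\<close>

lemma alt_gf_power_product:
  "alt_gf ((var_x - 1) ^ a * (var_y - 1) ^ b)
     = (- (1 - fps_X)) ^ a * (- geometric_fps) ^ b * geometric_fps"
proof (induction a)
  case 0
  show ?case
    by (induction b) (simp_all add: alt_gf_1 alt_gf_var_y_minus_1_mult del: mult_minus_left)
next
  case (Suc a)
  then show ?case
    by (simp add: mult.assoc alt_gf_var_x_minus_1_mult del: mult_minus_left)
qed

lemma sum_Pow_power_card: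
  fixes c :: "'b::comm_semiring_1"
  assumes "finite E"
  shows "(\<Sum>S\<in>Pow E. c ^ card S) = (1 + c) ^ card E"
  using prod_add [OF assms, of "\<lambda>_. c" "\<lambda>_. 1"] by (simp add: add.commute)

lemma alt_gf_tutte_poly:
  assumes "finite E" and r: "\<And>S. S \<subseteq> E \<Longrightarrow> r S \<le> min (r E) (card S)"
  shows "alt_gf (tutte_poly E r)
    = (-1) ^ (card E - r E) * (fps_X ^ card E * geometric_fps ^ Suc (card E - r E))"
proof -
  define u :: "int fps" where "u = - (1 - fps_X)"
  define v where "v = - geometric_fps"
  have uv: "u * v = 1"
    by (simp only: u_def v_def minus_mult_minus one_minus_X_mult_geometric_fps)
  have cancel: "u ^ k * v ^ k = 1" for k
    by (simp add: uv flip: power_mult_distrib)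
  \<comment> \<open>The rank bounds make the exponent subtractions exact; the surplus
    \<open>u ^ r S * v ^ r S\<close> is 1.\<close>
  have summand: "u ^ (r E - r S) * v ^ (card S - r S) = u ^ r E * v ^ card S" if "S \<subseteq> E" for S
  proof -
    have "u ^ r E = u ^ (r E - r S) * u ^ r S" "v ^ card S = v ^ (card S - r S) * v ^ r S"
      using r [OF that] by (simp_all flip: power_add)
    then have "u ^ r E * v ^ card S
        = u ^ (r E - r S) * v ^ (card S - r S) * (u ^ r S * v ^ r S)"
      by (simp only: mult_ac)
    then show ?thesis
      by (simp add: cancel)
  qed
  have v1: "1 + v = fps_X * v"
    using uv by (simp add: u_def algebra_simps)
  have "r E \<le> card E"
    using r [of E] by simp
  then have split: "v ^ card E = v ^ r E * v ^ (card E - r E)"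
    by (simp flip: power_add)
  have "alt_gf (tutte_poly E r)
      = (\<Sum>S\<in>Pow E. u ^ (r E - r S) * v ^ (card S - r S) * geometric_fps)"
    unfolding tutte_poly_def alt_gf_sum alt_gf_power_product u_def v_def ..
  also have "\<dots> = (\<Sum>S\<in>Pow E. u ^ r E * v ^ card S * geometric_fps)"
    by (intro sum.cong refl) (simp add: summand)
  also have "\<dots> = u ^ r E * (\<Sum>S\<in>Pow E. v ^ card S) * geometric_fps"
    by (simp add: sum_distrib_left sum_distrib_right)
  also have "\<dots> = u ^ r E * (fps_X * v) ^ card E * geometric_fps"
    by (simp add: sum_Pow_power_card [OF assms(1)] v1)
  \<comment> \<open>The powers of \<open>u\<close> cancel \<open>r E\<close> of the
    \<open>card E\<close> factors \<open>v\<close>; the remaining ones carry the sign.\<close>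
  also have "\<dots> = (u ^ r E * v ^ r E) * (fps_X ^ card E * v ^ (card E - r E) * geometric_fps)"
    by (simp only: power_mult_distrib split mult_ac)
  also have "\<dots> = (-1) ^ (card E - r E) * (fps_X ^ card E * geometric_fps ^ Suc (card E - r E))"
    unfolding cancel unfolding v_def power_minus [of geometric_fps] by (simp add: mult_ac)
  finally show ?thesis .
qed

lemma geometric_fps_power_nth: "fps_nth (geometric_fps ^ Suc n) k = int ((n + k) choose k)"
proof -
  define H where "H n = Abs_fps (\<lambda>k. int ((n + k) choose k))" for n
  have "geometric_fps ^ Suc n = H n"
  proof (induction n)
    case 0
    show ?case by (simp add: H_def geometric_fps_def)
  next
    case (Suc n)
    \<comment> \<open>Pascal's rule again, read as a recurrence in \<open>k\<close>.\<close>
    have "(1 - fps_X) * H (Suc n) = H n"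
      by (rule fps_ext) (auto simp: H_def left_diff_distrib gr0_conv_Suc)
    then have "H (Suc n) = geometric_fps * H n"
      using one_minus_X_mult_geometric_fps by (metis mult.assoc mult.commute mult_1)
    with Suc show ?case by simp
  qed
  then show ?thesis by (simp add: H_def)
qed

theorem theorem1p1:
  fixes E :: "'a set" and r :: "'a set \<Rightarrow> nat" and m h :: nat
  assumes "finite E"
    and "\<And>S. S \<subseteq> E \<Longrightarrow> r S \<le> min (r E) (card S)"
    and "m = card E"
  shows "(\<Sum>i=0..h. \<Sum>j=0..h-i. int ((h - i) choose j) * (-1) ^ j * tutte_coeff E r i j)
         = (-1) ^ (m - r E) * (if h < m then 0 else int ((h - r E) choose (h - m)))"
proof -
  have "r E \<le> m"
    using assms(2) [of E] assms(3) by simp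
  have "(\<Sum>i=0..h. \<Sum>j=0..h-i. int ((h - i) choose j) * (-1) ^ j * tutte_coeff E r i j)
      = fps_nth (alt_gf (tutte_poly E r)) h"
    by (simp add: alt_gf_def alt_binomial_sum_def tutte_coeff_def atLeast0AtMost)
  also have "\<dots> = fps_nth (fps_const ((-1) ^ (m - r E))
      * (fps_X ^ m * geometric_fps ^ Suc (m - r E))) h"
    by (simp only: alt_gf_tutte_poly [OF assms(1,2)] assms(3))
      (simp flip: fps_const_power fps_const_neg)
  also have "\<dots> = (-1) ^ (m - r E) * (if h < m then 0
      else fps_nth (geometric_fps ^ Suc (m - r E)) (h - m))"
    by (simp only: fps_mult_left_const_nth fps_X_power_mult_nth)
  \<comment> \<open>For r(E) \<le> m \<le> h the upper index (m - r(E)) + (h - m) is h -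
    r(E).\<close>
  also have "\<dots> = (-1) ^ (m - r E) * (if h < m then 0 else int ((h - r E) choose (h - m)))"
    using \<open>r E \<le> m\<close> by (simp only: geometric_fps_power_nth) simp
  finally show ?thesis .
qed

end
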